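(* Assume $N=2n$ is even. Then $G^{\theta}=Sp(V)$, and there are identifications $$G^{\iota\theta}_{\mathrm{uni}}\;\simeq\;\mathfrak g^{\theta}_{\mathrm{nil}}=\mathfrak{sp}(V)_{\mathrm{nil}},$$ and the behaviour of the $G^{\theta}$-orbits on $G^{\iota\theta}_{\mathrm{uni}}$ is the same as that of the $Sp(V)$-orbits on $\mathfrak{sp}(V)_{\mathrm{nil}}$: the isomorphism $G^{\iota\theta}_{\mathrm{uni}}\simeq\mathfrak{sp}(V)_{\mathrm{nil}}$ is compatible with the conjugation action of $G^{\theta}$ on the left and the adjoint action of $Sp(V)=G^{\theta}$ on the right.
   Context: $\mathbf k$ is an algebraically closed field of characteristic $2$, $n\ge 1$, $N=2n$. $V$ is an $N$-dimensional $\mathbf k$-vector space with basis $e_1,\dots,e_n,f_1,\dots,f_n$; $GL(V)$ is identified with $G=GL_N$ by this basis, and $\mathfrak g=\mathfrak{gl}_N=\mathrm{Lie}\,G$. Let $J=\begin{pmatrix}0&1_n\\1_n&0\end{pmatrix}$ and let $\theta:G\to G$ be the involutive automorphism $\theta(g)=J^{-1}({}^tg^{-1})J$; it induces the linear map $\theta(x)=J({}^tx)J$ on $\mathfrak g$ (recall $\mathrm{char}\,\mathbf k=2$). Notation: $G^\theta=\{g\in G:\theta(g)=g\}$, $G^{\iota\theta}=\{g\in G:\theta(g)=g^{-1}\}$, $G^{\iota\theta}_{\mathrm{uni}}$ is the set of unipotent elements of $G^{\iota\theta}$, $\mathfrak g^\theta=\{x\in\mathfrak g:\theta(x)=x\}$,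 and $\mathfrak g^\theta_{\mathrm{nil}}$ is its set of nilpotent elements. $G^\theta$ acts on $G^{\iota\theta}_{\mathrm{uni}}$ and $\mathfrak g^\theta_{\mathrm{nil}}$ by conjugation. $Sp(V)$ is the symplectic group of the alternating form on $V$ with Gram matrix $J$, i.e. $Sp(V)=\{g\in G:{}^tgJg=J\}$; $\mathfrak{sp}(V)$ is its Lie algebra and $\mathfrak{sp}(V)_{\mathrm{nil}}$ the set of nilpotent elements of $\mathfrak{sp}(V)$. *)

theory Defs
  imports
    "HOL-Analysis.Determinants"
    "HOL-Computational_Algebra.Computational_Algebra"
begin

text \<open>
  The index type \<open>'n + 'n\<close> lists the basis \<open>e\<^sub>1, \<dots>, e\<^sub>n, f\<^sub>1, \<dots>, f\<^sub>n\<close> of \<open>V\<close>, with \<open>n = CARD('n)\<close>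
  (so \<open>n \<ge> 1\<close>): \<open>Inl a\<close> stands for \<open>e\<^sub>a\<close> and \<open>Inr a\<close> for \<open>f\<^sub>a\<close>.
\<close>

type_synonym ('k, 'n) gl = "'k ^ ('n + 'n) ^ ('n + 'n)"

definition J_mat :: "('k::field, 'n::finite) gl" where
  "J_mat = (\<chi> i j. case (i, j) of
      (Inl a, Inr b) \<Rightarrow> (if a = b then 1 else 0)
    | (Inr a, Inl b) \<Rightarrow> (if a = b then 1 else 0)
    | _ \<Rightarrow> 0)"

definition GL :: "('k::field, 'n::finite) gl set" where
  "GL = {g. invertible g}"

definition theta_G :: "('k::field, 'n::finite) gl \<Rightarrow> ('k, 'n) gl" where
  "theta_G g = matrix_inv J_mat ** matrix_inv (transpose g) ** J_mat"

text \<open>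
  The differential of \<^const>\<open>theta_G\<close> at the identity is \<open>x \<mapsto> - J x\<^sup>T J\<close>; the sign disappears in
  characteristic 2, the only case considered.
\<close>

definition theta_g :: "('k::field, 'n::finite) gl \<Rightarrow> ('k, 'n) gl" where
  "theta_g x = J_mat ** transpose x ** J_mat"

text \<open>
  On the type \<open>'k ^ 'm ^ 'm\<close>, \<open>*\<close>, \<open>^\<close> and \<open>1\<close> are the componentwise operations, so powers of a matrix
  are written as iterated matrix products.
\<close>

definition nilpotent_mat :: "'k::field ^ 'm ^ 'm \<Rightarrow> bool" where
  "nilpotent_mat x \<longleftrightarrow> (\<exists>r. (((**) x) ^^ r) (mat 1) = 0)"

definition unipotent_mat :: "'k::field ^ 'm ^ 'm \<Rightarrow> bool" where
  "unipotent_mat g \<longleftrightarrow> nilpotent_mat (g - mat 1)"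

definition G_theta :: "('k::field, 'n::finite) gl set" where
  "G_theta = {g \<in> GL. theta_G g = g}"

definition G_iota_theta :: "('k::field, 'n::finite) gl set" where
  "G_iota_theta = {g \<in> GL. theta_G g = matrix_inv g}"

definition G_iota_theta_uni :: "('k::field, 'n::finite) gl set" where
  "G_iota_theta_uni = {g \<in> G_iota_theta. unipotent_mat g}"

definition g_theta :: "('k::field, 'n::finite) gl set" where
  "g_theta = {x. theta_g x = x}"

definition g_theta_nil :: "('k::field, 'n::finite) gl set" where
  "g_theta_nil = {x \<in> g_theta. nilpotent_mat x}"

definition Sp :: "('k::field, 'n::finite) gl set" where
  "Sp = {g \<in> GL. transpose g ** J_mat ** g = J_mat}"

text \<open>The coordinate ring of the affine space of all matrices.\<close>

inductive_set gl_regular :: "('k::field ^ 'm ^ 'm \<Rightarrow> 'k) set" where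
  const: "(\<lambda>_. c) \<in> gl_regular"
| entry: "(\<lambda>x. x $ i $ j) \<in> gl_regular"
| add: "p \<in> gl_regular \<Longrightarrow> q \<in> gl_regular \<Longrightarrow> (\<lambda>x. p x + q x) \<in> gl_regular"
| mult: "p \<in> gl_regular \<Longrightarrow> q \<in> gl_regular \<Longrightarrow> (\<lambda>x. p x * q x) \<in> gl_regular"

text \<open>The coordinate ring \<open>k[x\<^sub>i\<^sub>j, 1 / det]\<close> of the general linear group; values at singular matrices
  are irrelevant.\<close>

definition GL_regular :: "('k::field ^ 'm ^ 'm \<Rightarrow> 'k) set" where
  "GL_regular = {f. \<exists>p \<in> gl_regular. \<exists>r. \<forall>g. invertible g \<longrightarrow> f g = p g / det g ^ r}"

text \<open>
  The Lie algebra of a closed subgroup \<open>H\<close> of the general linear group, as the Zariski tangent space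
  at the identity: the directions \<open>x\<close> in which the differential at the identity of every polynomial
  \<open>f\<close> vanishing on \<open>H\<close> is zero. This differential is the derivative at \<open>t = 0\<close> of the polynomial
  \<open>q(t) = f(1 + t x)\<close>, which is determined by its values because the field is infinite in our setting.
\<close>

definition Lie_algebra :: "('k::field ^ 'm ^ 'm) set \<Rightarrow> ('k ^ 'm ^ 'm) set" where
  "Lie_algebra H = {x. \<forall>f \<in> gl_regular. (\<forall>h \<in> H. f h = 0) \<longrightarrow>
     (\<forall>q. (\<forall>t. poly q t = f (mat 1 + mat t ** x)) \<longrightarrow> poly (pderiv q) 0 = 0)}"

definition sp :: "('k::field, 'n::finite) gl set" where
  "sp = Lie_algebra Sp"

definition sp_nil :: "('k::field, 'n::finite) gl set" where
  "sp_nil = {x \<in> sp. nilpotent_mat x}"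

text \<open>
  Morphisms of affine varieties: \<open>X\<close> and \<open>Y\<close> are closed subsets of affine varieties with coordinate
  rings \<open>A\<close> and \<open>B\<close>, so that the regular functions on \<open>X\<close> and \<open>Y\<close> are the restrictions of elements
  of \<open>A\<close> and \<open>B\<close>.
\<close>

definition regular_map ::
    "('a \<Rightarrow> 'k) set \<Rightarrow> 'a set \<Rightarrow> ('b \<Rightarrow> 'k) set \<Rightarrow> 'b set \<Rightarrow> ('a \<Rightarrow> 'b) \<Rightarrow> bool" where
  "regular_map A X B Y \<phi> \<longleftrightarrow>
     \<phi> ` X \<subseteq> Y \<and> (\<forall>f \<in> B. \<exists>g \<in> A. \<forall>x \<in> X. f (\<phi> x) = g x)"

definition variety_isomorphism ::
    "('a \<Rightarrow> 'k) set \<Rightarrow> 'a set \<Rightarrow> ('b \<Rightarrow> 'k) set \<Rightarrow> 'b set \<Rightarrow> ('a \<Rightarrow> 'b) \<Rightarrow> bool" where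
  "variety_isomorphism A X B Y \<phi> \<longleftrightarrow> regular_map A X B Y \<phi> \<and>
     (\<exists>\<psi>. regular_map B Y A X \<psi> \<and> (\<forall>x \<in> X. \<psi> (\<phi> x) = x) \<and> (\<forall>y \<in> Y. \<phi> (\<psi> y) = y))"

text \<open>For a matrix group this is both conjugation on the group and the adjoint action on the Lie
  algebra.\<close>

definition conj_act :: "'k::field ^ 'm ^ 'm \<Rightarrow> 'k ^ 'm ^ 'm \<Rightarrow> 'k ^ 'm ^ 'm" where
  "conj_act h x = h ** x ** matrix_inv h"

definition conj_stable :: "('k::field ^ 'm ^ 'm) set \<Rightarrow> ('k ^ 'm ^ 'm) set \<Rightarrow> bool" where
  "conj_stable H X \<longleftrightarrow> (\<forall>h \<in> H. \<forall>x \<in> X. conj_act h x \<in> X)"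

definition conj_orbits :: "('k::field ^ 'm ^ 'm) set \<Rightarrow> ('k ^ 'm ^ 'm) set \<Rightarrow> ('k ^ 'm ^ 'm) set set" where
  "conj_orbits H X = (\<lambda>x. (\<lambda>h. conj_act h x) ` H) ` X"

end

theory Submission
  imports Defs
begin

no_notation fps_nth (infixl "$" 75)

text \<open>
  In characteristic 2, both conditions \<open>\<theta>(g) = g\<^sup>-\<^sup>1\<close> on the group and \<open>\<theta>(x) = x\<close> on the Lie algebra
  say that \<open>J g\<close>, respectively \<open>J x\<close>, is symmetric. Since \<open>J\<close> itself is symmetric, \<open>g \<mapsto> g - 1\<close> is the
  required equivariant isomorphism; its inverse is regular for the coordinate ring
  \<open>k[x\<^sub>i\<^sub>j, 1 / det]\<close> because unipotent matrices have determinant 1. That the symmetric matrices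
  \<open>J x\<close> are exactly those with \<open>x \<in> sp(V)\<close> is seen from the defining equations of \<open>Sp(V)\<close> in one
  direction, and in the other from the transvections \<open>1 + t J v v\<^sup>T\<close>, which are lines in \<open>Sp(V)\<close>
  through 1 whose directions span the matrices \<open>x\<close> with \<open>J x\<close> symmetric.
\<close>

section \<open>Matrices\<close>

lemma matrix_add_rdistrib: "(A + B) ** C = A ** C + B ** (C :: 'a::semiring_1 ^ 'n ^ 'm)"
  by (simp add: vec_eq_iff matrix_matrix_mult_def sum.distrib distrib_right)

lemma matrix_diff_ldistrib: "A ** (B - C) = A ** B - A ** (C :: 'a::ring_1 ^ 'n ^ 'm)"
  by (simp add: vec_eq_iff matrix_matrix_mult_def sum_subtractf right_diff_distrib)

lemma matrix_diff_rdistrib: "(A - B) ** C = A ** C - B ** (C :: 'a::ring_1 ^ 'n ^ 'm)"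
  by (simp add: vec_eq_iff matrix_matrix_mult_def sum_subtractf left_diff_distrib)

lemma transpose_add: "transpose (A + B) = transpose A + transpose B"
  by (simp add: vec_eq_iff transpose_def)

lemma transpose_diff: "transpose (A - B) = transpose A - transpose B"
  by (simp add: vec_eq_iff transpose_def)

lemma mat_mult_nth: "(mat t ** A) $ i $ j = t * (A $ i $ j)"
  for A :: "'a::semiring_1 ^ 'n ^ 'm"
  by (simp add: matrix_matrix_mult_def mat_def if_distrib [where f = "\<lambda>x. x * _"] cong: if_cong)

lemma mult_mat_left_commute: "A ** (mat t ** B) = mat t ** (A ** B)"
  for A :: "'a::comm_semiring_1 ^ 'n ^ 'm" and B :: "'a ^ 'p ^ 'n"
proof -
  have nth: "(A ** C) $ i $ j = (\<Sum>k\<in>UNIV. A $ i $ k * C $ k $ j)" for C :: "'a ^ 'p ^ 'n" and i j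
    by (simp add: matrix_matrix_mult_def)
  show ?thesis
    by (simp add: vec_eq_iff mat_mult_nth nth sum_distrib_left mult.left_commute)
qed

lemma matrix_inv:
  assumes "invertible A"
  shows "A ** matrix_inv A = mat 1" "matrix_inv A ** A = mat 1"
  using someI_ex [OF assms [unfolded invertible_def]] by (auto simp: matrix_inv_def)

lemma matrix_mult_eq_iff:
  fixes P Q :: "'a::semiring_1 ^ 'n ^ 'n"
  assumes "P ** Q = mat 1" "Q ** P = mat 1"
  shows "Q ** A = B \<longleftrightarrow> A = P ** B" "C ** Q = D \<longleftrightarrow> C = D ** P"
proof -
  show "Q ** A = B \<longleftrightarrow> A = P ** B"
    using assms by (auto simp: matrix_mul_assoc)
  show "C ** Q = D \<longleftrightarrow> C = D ** P"
    using assms by (auto simp flip: matrix_mul_assoc)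
qed

lemma matrix_inv_unique:
  fixes A :: "'a::field ^ 'n ^ 'n"
  assumes "A ** B = mat 1"
  shows "matrix_inv A = B"
proof -
  have "invertible A"
    using assms invertible_right_inverse by blast
  have "matrix_inv A = matrix_inv A ** (A ** B)"
    by (simp add: assms)
  also have "\<dots> = B"
    by (simp add: matrix_mul_assoc matrix_inv [OF \<open>invertible A\<close>])
  finally show ?thesis .
qed

lemma matrix_inv_transpose:
  fixes A :: "'a::field ^ 'n ^ 'n"
  assumes "invertible A"
  shows "matrix_inv (transpose A) = transpose (matrix_inv A)"
  by (rule matrix_inv_unique) (metis assms matrix_inv(2) matrix_transpose_mul transpose_mat)

lemma conj_act_diff: "conj_act h (x - y) = conj_act h x - conj_act h y"
  by (simp add: conj_act_def matrix_diff_ldistrib matrix_diff_rdistrib)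

lemma conj_act_mat_1: "invertible h \<Longrightarrow> conj_act h (mat 1) = mat 1"
  by (simp add: conj_act_def matrix_inv)

lemma conj_act_mult:
  "invertible h \<Longrightarrow> conj_act h (x ** y) = conj_act h x ** conj_act h y"
  by (simp add: conj_act_def matrix_mul_assoc)
    (metis matrix_inv(2) matrix_mul_assoc matrix_mul_rid)

lemma nilpotent_mat_conj_act:
  assumes "invertible h" "nilpotent_mat x"
  shows "nilpotent_mat (conj_act h x)"
proof -
  \<comment> \<open>Conjugation is multiplicative and fixes the identity, so it passes through
    powers.\<close>
  have "((**) (conj_act h x) ^^ r) (mat 1) = conj_act h (((**) x ^^ r) (mat 1))" for r
    by (induction r) (simp_all add: conj_act_mat_1 conj_act_mult assms(1))
  then show ?thesis
    using assms(2) by (metis conj_act_def nilpotent_mat_def times0_left times0_right)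
qed

lemma unipotent_mat_conj_act:
  "invertible h \<Longrightarrow> unipotent_mat g \<Longrightarrow> unipotent_mat (conj_act h g)"
  using nilpotent_mat_conj_act [of h "g - mat 1"]
  by (simp add: unipotent_mat_def conj_act_diff conj_act_mat_1)

lemma matrix_power_square: "((**) (x ** x) ^^ r) A = ((**) x ^^ (2 * r)) A"
  for x :: "'a::semiring_1 ^ 'n ^ 'n"
  by (induction r) (simp_all add: matrix_mul_assoc)

section \<open>Characteristic 2\<close>

lemma double_CHAR_2: "CHAR('a::ring_1) = 2 \<Longrightarrow> x + x = (0 :: 'a)"
  by (metis minus_CHAR_2 diff_self)

lemma double_mat_CHAR_2: "CHAR('a::ring_1) = 2 \<Longrightarrow> A + A = (0 :: 'a ^ 'n ^ 'm)"
  by (simp add: vec_eq_iff double_CHAR_2)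

lemma add_eq_0_iff_CHAR_2: "CHAR('a::ring_1) = 2 \<Longrightarrow> A + B = 0 \<longleftrightarrow> A = (B :: 'a ^ 'n ^ 'm)"
  by (metis add.right_cancel double_mat_CHAR_2)

text \<open>In characteristic 2, (1 + x)^2 = 1 + x^2. So squaring the determinant replaces x by x^2,
  whose nilpotency exponent is about half as large, and induction applies. A field element with
  square 1 is 1 because -1 = 1.\<close>

lemma det_one_plus_nilpotent:
  fixes x :: "'a::field ^ 'n ^ 'n"
  assumes char: "CHAR('a) = 2" and "nilpotent_mat x"
  shows "det (mat 1 + x) = 1"
proof -
  obtain r where "((**) x ^^ r) (mat 1) = 0"
    using assms(2) by (auto simp: nilpotent_mat_def)
  then show ?thesis
  proof (induction r arbitrary: x rule: less_induct)
    case (less r)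
    show ?case
    proof (cases "r \<le> 1")
      case True
      then have "r = 0 \<or> r = 1"
        by auto
      then have "x = 0"
      proof
        \<comment> \<open>The hypothesis now reads 1 = 0, and multiplying x by it gives x =
          0.\<close>
        assume "r = 0"
        then have "mat 1 = (0 :: 'a ^ 'n ^ 'n)"
          using less.prems by simp
        then show "x = 0"
          by (metis matrix_mul_rid times0_right)
      qed (use less.prems in simp)
      then show ?thesis
        by simp
    next
      case False
      \<comment> \<open>Half of r, rounded up: power 2s of x is power r or one factor beyond it,
        hence zero. The bound s < r requires r to be at least 2, whence the case split.\<close>
      define s where "s = (r + 1) div 2"
      have "s < r" "2 * s = r \<or> 2 * s = Suc r"
        using False by (auto simp: s_def)
      then have "((**) (x ** x) ^^ s) (mat 1) = 0"
        using less.prems by (auto simp: matrix_power_square)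
      then have "det (mat 1 + x ** x) = 1"
        using \<open>s < r\<close> by (rule less.IH [rotated])
      moreover have "mat 1 + x ** x = (mat 1 + x) ** (mat 1 + x)"
        using double_mat_CHAR_2 [OF char, of x]
        by (simp add: matrix_add_ldistrib matrix_add_rdistrib add.assoc)
      ultimately have "det (mat 1 + x) * det (mat 1 + x) = 1"
        by (simp add: det_mul)
      then show ?thesis
        using uminus_CHAR_2 [OF char, of 1] by (auto simp: square_eq_1_iff)
    qed
  qed
qed

section \<open>The involution and the symplectic group\<close>

lemma J_mat_nth:
  "J_mat $ Inl a $ Inl b = 0" "J_mat $ Inl a $ Inr b = (if a = b then 1 else 0)"
  "J_mat $ Inr a $ Inr b = 0" "J_mat $ Inr a $ Inl b = (if a = b then 1 else 0)"
  by (simp_all add: J_mat_def)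

lemma sum_UNIV_Plus: "(\<Sum>k\<in>UNIV. f k) = (\<Sum>a\<in>UNIV. f (Inl a)) + (\<Sum>a\<in>UNIV. f (Inr a))"
  for f :: "'a::finite + 'b::finite \<Rightarrow> 'c::comm_monoid_add"
  by (simp add: sum.Plus flip: UNIV_Plus_UNIV)

lemma J_mat_J_mat: "J_mat ** J_mat = (mat 1 :: ('a::field, 'n::finite) gl)"
proof -
  have "(J_mat ** J_mat :: ('a, 'n) gl) $ i $ j = mat 1 $ i $ j" for i j
    by (cases i; cases j)
      (simp_all add: matrix_matrix_mult_def mat_def sum_UNIV_Plus J_mat_nth
        if_distrib [where f = "\<lambda>x. x * _"] cong: if_cong)
  then show ?thesis
    by (simp add: vec_eq_iff)
qed

lemma transpose_J_mat: "transpose J_mat = J_mat"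
  by (auto simp: vec_eq_iff transpose_def J_mat_def split: sum.split)

lemma J_mat_diagonal: "J_mat $ i $ i = 0"
  by (simp add: J_mat_def split: sum.split)

lemma J_mat_symmetric: "J_mat $ i $ j = J_mat $ j $ i"
  by (auto simp: J_mat_def split: sum.split)

lemma J_mat_cancel: "J_mat ** (J_mat ** A) = A" "B ** J_mat ** J_mat = B"
  by (simp add: matrix_mul_assoc J_mat_J_mat)
    (simp add: matrix_mul_assoc [symmetric] J_mat_J_mat)

lemma J_mat_mult_eq_iff: "J_mat ** A = B \<longleftrightarrow> A = J_mat ** B"
  using J_mat_cancel(1) by auto

lemma matrix_inv_J_mat: "matrix_inv J_mat = J_mat"
  by (rule matrix_inv_unique) (rule J_mat_J_mat)

text \<open>Since J squares to 1, the equation exhibits J g^T J as a left inverse of g, which gives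
  membership in \<open>GL\<close>.\<close>

lemma Sp_iff: "g \<in> Sp \<longleftrightarrow> transpose g ** J_mat ** g = J_mat"
proof -
  have "invertible g" if "transpose g ** J_mat ** g = J_mat"
  proof -
    have "(J_mat ** transpose g ** J_mat) ** g = mat 1"
      using that J_mat_J_mat by (metis matrix_mul_assoc)
    then show ?thesis
      using invertible_left_inverse by blast
  qed
  then show ?thesis
    by (auto simp: Sp_def GL_def)
qed

lemma theta_G_eq:
  assumes "invertible g"
  shows "theta_G g = J_mat ** transpose (matrix_inv g) ** J_mat"
  by (simp add: theta_G_def matrix_inv_J_mat matrix_inv_transpose assms)

text \<open>Multiplying theta(g) = g on the left by J and then by g^T clears the inverse and leaves
  the symplectic equation.\<close>

lemma G_theta_eq_Sp: "G_theta = Sp"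
proof -
  have "theta_G g = g \<longleftrightarrow> transpose g ** J_mat ** g = J_mat" if g: "invertible g"
    for g :: "('a::field, 'n::finite) gl"
  proof -
    have inv: "transpose g ** transpose (matrix_inv g) = mat 1"
      "transpose (matrix_inv g) ** transpose g = mat 1"
      by (simp_all add: matrix_transpose_mul [symmetric] matrix_inv g)
    have "theta_G g = g \<longleftrightarrow> transpose (matrix_inv g) ** J_mat = J_mat ** g"
      by (simp add: theta_G_eq g J_mat_mult_eq_iff matrix_mul_assoc [symmetric])
    also have "\<dots> \<longleftrightarrow> J_mat = transpose g ** J_mat ** g"
      by (simp add: matrix_mult_eq_iff(1) [OF inv] matrix_mul_assoc)
    finally show ?thesis
      by auto
  qed
  then show ?thesis
    by (auto simp: G_theta_def Sp_def GL_def)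
qed

text \<open>Clearing inverses leaves an equation that is linear in g, the same one that
  \<open>g_theta_iff\<close> gives on the Lie algebra. This linearity is what lets a translation
  carry one set to the other.\<close>

lemma G_iota_theta_iff:
  "g \<in> G_iota_theta \<longleftrightarrow> invertible g \<and> J_mat ** g = transpose g ** J_mat"
proof -
  have "theta_G g = matrix_inv g \<longleftrightarrow> J_mat ** g = transpose g ** J_mat" if g: "invertible g"
  proof -
    have inv: "transpose g ** transpose (matrix_inv g) = mat 1"
      "transpose (matrix_inv g) ** transpose g = mat 1"
      by (simp_all add: matrix_transpose_mul [symmetric] matrix_inv g)
    have "theta_G g = matrix_inv g \<longleftrightarrow> transpose (matrix_inv g) ** J_mat = J_mat ** matrix_inv g"
      by (simp add: theta_G_eq g J_mat_mult_eq_iff matrix_mul_assoc [symmetric])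
    also have "\<dots> \<longleftrightarrow> J_mat = transpose g ** J_mat ** matrix_inv g"
      by (simp add: matrix_mult_eq_iff(1) [OF inv] matrix_mul_assoc)
    also have "\<dots> \<longleftrightarrow> J_mat ** g = transpose g ** J_mat"
      using matrix_mult_eq_iff(2) [OF matrix_inv [OF g]] by metis
    finally show ?thesis .
  qed
  then show ?thesis
    by (auto simp: G_iota_theta_def GL_def)
qed

lemma g_theta_iff: "x \<in> g_theta \<longleftrightarrow> J_mat ** x = transpose x ** J_mat"
  by (auto simp: g_theta_def theta_g_def J_mat_mult_eq_iff matrix_mul_assoc)

text \<open>For h in \<open>Sp\<close>, J h = k^T J with k the inverse of h. Hence J (h x k) = k^T
  (J x) k is congruent to J x, and congruence preserves symmetry.\<close>

lemma J_symmetric_conj_act: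
  assumes h: "h \<in> Sp" and x: "J_mat ** x = transpose x ** J_mat"
  shows "J_mat ** conj_act h x = transpose (conj_act h x) ** J_mat"
proof -
  define k where "k = matrix_inv h"
  have hk: "h ** k = mat 1"
    using h by (auto simp: k_def Sp_def GL_def matrix_inv)
  have J: "transpose h ** J_mat ** h = J_mat"
    using h by (simp add: Sp_iff)
  have kh': "transpose k ** transpose h = mat 1"
    by (simp add: matrix_transpose_mul [symmetric] hk)
  have Jk: "J_mat ** k = transpose h ** J_mat"
    by (metis J hk matrix_mul_assoc matrix_mul_rid)
  have Jh: "J_mat ** h = transpose k ** J_mat"
    by (metis J kh' matrix_mul_assoc matrix_mul_lid)
  have "J_mat ** (h ** x ** k) = transpose k ** (J_mat ** x) ** k"
    by (simp add: matrix_mul_assoc Jh)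
  also have "\<dots> = transpose k ** transpose x ** (J_mat ** k)"
    by (simp add: x matrix_mul_assoc)
  also have "\<dots> = transpose (h ** x ** k) ** J_mat"
    by (simp add: Jk matrix_transpose_mul matrix_mul_assoc)
  finally show ?thesis
    by (simp add: conj_act_def k_def)
qed

lemma invertible_conj_act: "invertible h \<Longrightarrow> invertible x \<Longrightarrow> invertible (conj_act h x)"
  unfolding conj_act_def by (metis invertible_def invertible_mult matrix_inv)

lemma Sp_invertible: "h \<in> Sp \<Longrightarrow> invertible h"
  by (simp add: Sp_def GL_def)

lemma conj_stable_G_iota_theta_uni: "conj_stable Sp G_iota_theta_uni"
  unfolding conj_stable_def G_iota_theta_uni_def mem_Collect_eq G_iota_theta_iff
  using Sp_invertible invertible_conj_act J_symmetric_conj_act unipotent_mat_conj_act by blast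

lemma conj_stable_g_theta_nil: "conj_stable Sp g_theta_nil"
  unfolding conj_stable_def g_theta_nil_def mem_Collect_eq g_theta_iff
  using Sp_invertible J_symmetric_conj_act nilpotent_mat_conj_act by blast

section \<open>Regular functions and their differentials at the identity\<close>

lemma gl_regular_sum:
  "(\<And>i. i \<in> A \<Longrightarrow> f i \<in> gl_regular) \<Longrightarrow> (\<lambda>x. \<Sum>i\<in>A. f i x) \<in> gl_regular"
  by (induction A rule: infinite_finite_induct) (auto intro: gl_regular.intros)

lemma gl_regular_translate:
  assumes "f \<in> gl_regular"
  shows "(\<lambda>x. f (x + a)) \<in> gl_regular"
  using assms by induction (auto intro: gl_regular.intros)

text \<open>The coefficients \<open>c\<close> are chosen before the direction \<open>x\<close>: the
  derivative at 1 is one linear form in all directions, which later makes testing on a spanning set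
  of directions sufficient.\<close>

lemma gl_regular_differential:
  fixes f :: "'k::field ^ 'm::finite ^ 'm \<Rightarrow> 'k"
  assumes "f \<in> gl_regular"
  shows "\<exists>c. \<forall>x. \<exists>q. (\<forall>t. poly q t = f (mat 1 + mat t ** x)) \<and>
           poly (pderiv q) 0 = (\<Sum>i\<in>UNIV. \<Sum>j\<in>UNIV. c i j * (x $ i $ j))"
  using assms
proof induction
  case (const c)
  then show ?case
    by (intro exI [of _ "\<lambda>_ _. 0"] allI exI [of _ "[:c:]"]) simp
next
  case (entry a b)
  have "(\<Sum>i\<in>UNIV. \<Sum>j\<in>UNIV. (if i = a \<and> j = b then 1 else 0) * (x $ i $ j)) = x $ a $ b"
    for x :: "'k ^ 'm ^ 'm"
  proof -
    have "(\<Sum>i\<in>UNIV. \<Sum>j\<in>UNIV. (if i = a \<and> j = b then 1 else 0) * (x $ i $ j)) =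
        (\<Sum>i\<in>UNIV. if i = a then \<Sum>j\<in>UNIV. if j = b then x $ i $ j else 0 else 0)"
      by (intro sum.cong refl) (auto simp: if_distrib [where f = "\<lambda>c. c * _"] cong: if_cong)
    then show ?thesis
      by simp
  qed
  then have poly: "(\<forall>t. poly [:mat 1 $ a $ b, x $ a $ b:] t = (mat 1 + mat t ** x) $ a $ b) \<and>
      poly (pderiv [:mat 1 $ a $ b, x $ a $ b:]) 0 =
        (\<Sum>i\<in>UNIV. \<Sum>j\<in>UNIV. (if i = a \<and> j = b then 1 else 0) * (x $ i $ j))"
    for x :: "'k ^ 'm ^ 'm"
    by (simp add: mat_mult_nth pderiv_pCons)
  show ?case
    by (intro exI [of _ "\<lambda>i j. if i = a \<and> j = b then 1 else 0"] allI) (rule exI, rule poly)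
next
  case (add p q)
  then obtain c d where
    c: "\<And>x. \<exists>r. (\<forall>t. poly r t = p (mat 1 + mat t ** x)) \<and>
          poly (pderiv r) 0 = (\<Sum>i\<in>UNIV. \<Sum>j\<in>UNIV. c i j * (x $ i $ j))" and
    d: "\<And>x. \<exists>r. (\<forall>t. poly r t = q (mat 1 + mat t ** x)) \<and>
          poly (pderiv r) 0 = (\<Sum>i\<in>UNIV. \<Sum>j\<in>UNIV. d i j * (x $ i $ j))"
    by blast
  show ?case
  proof (intro exI [of _ "\<lambda>i j. c i j + d i j"] allI)
    fix x :: "'k ^ 'm ^ 'm"
    obtain r s where "\<forall>t. poly r t = p (mat 1 + mat t ** x)"
      "poly (pderiv r) 0 = (\<Sum>i\<in>UNIV. \<Sum>j\<in>UNIV. c i j * (x $ i $ j))"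
      "\<forall>t. poly s t = q (mat 1 + mat t ** x)"
      "poly (pderiv s) 0 = (\<Sum>i\<in>UNIV. \<Sum>j\<in>UNIV. d i j * (x $ i $ j))"
      using c d by metis
    then show "\<exists>r. (\<forall>t. poly r t = p (mat 1 + mat t ** x) + q (mat 1 + mat t ** x)) \<and>
        poly (pderiv r) 0 = (\<Sum>i\<in>UNIV. \<Sum>j\<in>UNIV. (c i j + d i j) * (x $ i $ j))"
      by (intro exI [of _ "r + s"]) (simp add: pderiv_add distrib_right sum.distrib)
  qed
next
  case (mult p q)
  then obtain c d where
    c: "\<And>x. \<exists>r. (\<forall>t. poly r t = p (mat 1 + mat t ** x)) \<and>
          poly (pderiv r) 0 = (\<Sum>i\<in>UNIV. \<Sum>j\<in>UNIV. c i j * (x $ i $ j))" and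
    d: "\<And>x. \<exists>r. (\<forall>t. poly r t = q (mat 1 + mat t ** x)) \<and>
          poly (pderiv r) 0 = (\<Sum>i\<in>UNIV. \<Sum>j\<in>UNIV. d i j * (x $ i $ j))"
    by blast
  show ?case
  \<comment> \<open>The product rule at t = 0, where \<open>r\<close> and \<open>s\<close> take the
    values of \<open>p\<close> and \<open>q\<close> at the identity.\<close>
  proof (intro exI [of _ "\<lambda>i j. p (mat 1) * d i j + q (mat 1) * c i j"] allI)
    fix x :: "'k ^ 'm ^ 'm"
    obtain r s where r: "\<forall>t. poly r t = p (mat 1 + mat t ** x)"
      "poly (pderiv r) 0 = (\<Sum>i\<in>UNIV. \<Sum>j\<in>UNIV. c i j * (x $ i $ j))"
      and s: "\<forall>t. poly s t = q (mat 1 + mat t ** x)"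
      "poly (pderiv s) 0 = (\<Sum>i\<in>UNIV. \<Sum>j\<in>UNIV. d i j * (x $ i $ j))"
      using c d by metis
    then have "poly (pderiv (r * s)) 0 = p (mat 1) * (\<Sum>i\<in>UNIV. \<Sum>j\<in>UNIV. d i j * (x $ i $ j)) +
        q (mat 1) * (\<Sum>i\<in>UNIV. \<Sum>j\<in>UNIV. c i j * (x $ i $ j))"
      by (simp add: pderiv_mult)
    also have "\<dots> =
        (\<Sum>i\<in>UNIV. \<Sum>j\<in>UNIV. (p (mat 1) * d i j + q (mat 1) * c i j) * (x $ i $ j))"
      by (simp add: distrib_right sum.distrib sum_distrib_left mult.assoc)
    finally show "\<exists>r. (\<forall>t. poly r t = p (mat 1 + mat t ** x) * q (mat 1 + mat t ** x)) \<and>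
        poly (pderiv r) 0 =
          (\<Sum>i\<in>UNIV. \<Sum>j\<in>UNIV. (p (mat 1) * d i j + q (mat 1) * c i j) * (x $ i $ j))"
      using r(1) s(1) by (intro exI [of _ "r * s"]) simp
  qed
qed

text \<open>Over a finite field, 1 plus the product of all X - a is nonconstant and takes only the
  value 1, so it has no root.\<close>

lemma infinite_UNIV_alg_closed: "infinite (UNIV :: 'k::alg_closed_field set)"
proof
  assume fin: "finite (UNIV :: 'k set)"
  define p where "p = 1 + (\<Prod>a\<in>(UNIV :: 'k set). [:- a, 1:])"
  have "degree (\<Prod>a\<in>(UNIV :: 'k set). [:- a, 1:]) = card (UNIV :: 'k set)"
    by (simp add: degree_prod_sum_eq)
  then have "degree p > 0"
    using fin by (simp add: p_def degree_add_eq_right finite_UNIV_card_ge_0)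
  then obtain x where "poly p x = 0"
    using alg_closed_imp_poly_has_root by blast
  moreover have "poly p x = 1"
    using fin by (auto simp: p_def poly_prod intro: prod_zero)
  ultimately show False
    by simp
qed

text \<open>\<open>Lie_algebra\<close> quantifies over every polynomial representing f along a line.
  This identifies each of them with the one from \<open>gl_regular_differential\<close>.\<close>

lemma poly_eq_of_infinite_field:
  fixes p q :: "'k::field poly"
  assumes "infinite (UNIV :: 'k set)" "\<And>t. poly p t = poly q t"
  shows "p = q"
  using poly_roots_finite [of "p - q"] assms by auto

section \<open>The symplectic Lie algebra\<close>

text \<open>The diagonal condition is not redundant in characteristic 2.\<close>

lemma sum_alternating_eq_0:
  fixes T :: "'i \<Rightarrow> 'i \<Rightarrow> 'a::ab_group_add"
  assumes "finite A" "\<And>i. T i i = 0" "\<And>i j. T i j + T j i = 0"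
  shows "(\<Sum>i\<in>A. \<Sum>j\<in>A. T i j) = 0"
  using assms(1)
proof induction
  case (insert a A)
  \<comment> \<open>The new index contributes its diagonal term and the pairs of mirrored terms with
    the old indices.\<close>
  have "(\<Sum>i\<in>insert a A. \<Sum>j\<in>insert a A. T i j) =
      T a a + (\<Sum>j\<in>A. T a j + T j a) + (\<Sum>i\<in>A. \<Sum>j\<in>A. T i j)"
    using insert by (simp add: sum.distrib add_ac)
  then show ?case
    using insert assms(2,3) by simp
qed simp

definition outer :: "'k::semiring_1 ^ 'm \<Rightarrow> 'k ^ 'm ^ 'm" where
  "outer v = (\<chi> i j. v $ i * v $ j)"

text \<open>For symmetric W, expanding (1 + J W)^T J (1 + J W) gives J + 2W + W J W. The middle term
  vanishes in characteristic 2. The last contains the scalar v^T J v, which is zero because J is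
  alternating.\<close>

lemma transvection_in_Sp:
  fixes v :: "'k::field ^ ('n::finite + 'n)"
  assumes char: "CHAR('k) = 2"
  shows "mat 1 + mat t ** (J_mat ** outer v) \<in> (Sp :: ('k, 'n) gl set)"
proof -
  define W where "W = mat t ** outer v"
  have W: "W $ i $ j = t * (v $ i * v $ j)" for i j
    by (simp add: W_def mat_mult_nth outer_def)
  have sym: "transpose W = W"
    by (simp add: vec_eq_iff transpose_def W mult_ac)
  have form: "(\<Sum>k\<in>UNIV. \<Sum>l\<in>UNIV. v $ l * J_mat $ l $ k * v $ k) = 0"
    by (rule sum_alternating_eq_0)
      (simp_all add: J_mat_diagonal J_mat_symmetric [of "_ :: 'n + 'n"] double_CHAR_2 char mult_ac)
  have "(W ** J_mat ** W) $ i $ j = 0" for i j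
  proof -
    have "(W ** J_mat ** W) $ i $ j =
        (t * v $ i * t * v $ j) * (\<Sum>k\<in>UNIV. \<Sum>l\<in>UNIV. v $ l * J_mat $ l $ k * v $ k)"
      by (simp add: matrix_matrix_mult_def W sum_distrib_left sum_distrib_right mult_ac)
    then show ?thesis
      by (simp only: form mult_zero_right)
  qed
  then have WJW: "W ** J_mat ** W = 0"
    by (simp add: vec_eq_iff)
  define g :: "('k, 'n) gl" where "g = mat 1 + J_mat ** W"
  have "transpose g ** J_mat ** g = J_mat + (W + W) + W ** J_mat ** W"
    by (simp add: g_def transpose_add matrix_transpose_mul sym transpose_J_mat
        matrix_add_ldistrib matrix_add_rdistrib J_mat_cancel add.assoc)
      (simp add: matrix_mul_assoc J_mat_cancel)
  also have "\<dots> = J_mat"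
    by (simp add: WJW double_mat_CHAR_2 [OF char])
  finally have "g \<in> Sp"
    by (simp add: Sp_iff)
  then show ?thesis
    by (simp add: g_def W_def mult_mat_left_commute)
qed

text \<open>Each entry of g^T J g - J vanishes on \<open>Sp\<close>, and its derivative at 1 along x
  is the matching entry of J x + x^T J. In characteristic 2 a vanishing sum is an equality.\<close>

lemma sp_subset_g_theta:
  fixes x :: "('k::field, 'n::finite) gl"
  assumes char: "CHAR('k) = 2" and x: "x \<in> sp"
  shows "x \<in> g_theta"
proof -
  have "(J_mat ** x + transpose x ** J_mat) $ i $ j = 0" for i j
  proof -
    \<comment> \<open>The difference is written as a sum with a negated constant to fit the closure
      rules of \<open>gl_regular\<close>.\<close>
    define f :: "('k, 'n) gl \<Rightarrow> 'k" where
      "f = (\<lambda>g. (transpose g ** J_mat ** g) $ i $ j + - (J_mat $ i $ j))"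
    have "f \<in> gl_regular"
      unfolding f_def matrix_matrix_mult_def transpose_def
      by (simp only: vec_lambda_beta, intro gl_regular.add gl_regular_sum gl_regular.mult gl_regular.const
          gl_regular.entry)
    moreover have "\<forall>h\<in>Sp. f h = 0"
      by (simp add: f_def Sp_iff)
    moreover define q where
      "q = [:0, (J_mat ** x + transpose x ** J_mat) $ i $ j, (transpose x ** J_mat ** x) $ i $ j:]"
    have "poly q t = f (mat 1 + mat t ** x)" for t
    proof -
      define y where "y = mat t ** x"
      have tr: "transpose y = mat t ** transpose x"
        by (simp add: y_def vec_eq_iff transpose_def mat_mult_nth)
      have "transpose (mat 1 + y) ** J_mat ** (mat 1 + y) =
          J_mat + J_mat ** y + transpose y ** J_mat + transpose y ** (J_mat ** y)"
        by (simp add: transpose_add matrix_add_ldistrib matrix_add_rdistrib matrix_mul_assoc)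
      moreover have "J_mat ** y = mat t ** (J_mat ** x)"
        by (simp add: y_def mult_mat_left_commute)
      moreover have "transpose y ** J_mat = mat t ** (transpose x ** J_mat)"
        by (simp add: tr matrix_mul_assoc)
      moreover have "transpose y ** (mat t ** (J_mat ** x)) =
          mat t ** (mat t ** (transpose x ** J_mat ** x))"
        by (simp add: tr mult_mat_left_commute [of "transpose x"] flip: matrix_mul_assoc)
      ultimately have "transpose (mat 1 + y) ** J_mat ** (mat 1 + y) =
          J_mat + mat t ** (J_mat ** x) + mat t ** (transpose x ** J_mat) +
          mat t ** (mat t ** (transpose x ** J_mat ** x))"
        by simp
      then show ?thesis
        by (simp add: f_def q_def mat_mult_nth algebra_simps flip: y_def)
    qed
    ultimately have "poly (pderiv q) 0 = 0"
      using x unfolding sp_def Lie_algebra_def by blast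
    then show ?thesis
      by (simp add: q_def pderiv_pCons)
  qed
  then have "J_mat ** x + transpose x ** J_mat = 0"
    by (simp add: vec_eq_iff)
  then show ?thesis
    by (simp add: g_theta_iff add_eq_0_iff_CHAR_2 [OF char])
qed

text \<open>The spanning argument in dual form: the differential of f, pulled back along S to J S,
  kills every v v^T. Its coefficient matrix \<open>d\<close> is therefore alternating and pairs to
  zero with all symmetric S.\<close>

lemma g_theta_subset_sp:
  fixes x :: "('k::field, 'n::finite) gl"
  assumes inf: "infinite (UNIV :: 'k set)" and char: "CHAR('k) = 2" and x: "x \<in> g_theta"
  shows "x \<in> sp"
  unfolding sp_def Lie_algebra_def
proof (intro CollectI ballI impI allI)
  fix f :: "('k, 'n) gl \<Rightarrow> 'k" and q
  assume f: "f \<in> gl_regular" and vanish: "\<forall>h\<in>Sp. f h = 0"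
    and q: "\<forall>t. poly q t = f (mat 1 + mat t ** x)"
  obtain c where c: "\<And>y. \<exists>q. (\<forall>t. poly q t = f (mat 1 + mat t ** y)) \<and>
      poly (pderiv q) 0 = (\<Sum>i\<in>UNIV. \<Sum>j\<in>UNIV. c i j * (y $ i $ j))"
    using gl_regular_differential [OF f] by blast
  define d where "d k j = (\<Sum>i\<in>UNIV. c i j * J_mat $ i $ k)" for k j
  have deriv: "poly (pderiv p) 0 = (\<Sum>k\<in>UNIV. \<Sum>j\<in>UNIV. d k j * (S $ k $ j))"
    if p: "\<forall>t. poly p t = f (mat 1 + mat t ** (J_mat ** S))" for p S
  proof -
    obtain p' where p': "\<forall>t. poly p' t = f (mat 1 + mat t ** (J_mat ** S))"
      "poly (pderiv p') 0 = (\<Sum>i\<in>UNIV. \<Sum>j\<in>UNIV. c i j * ((J_mat ** S) $ i $ j))"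
      using c by blast
    have "p = p'"
      using p p'(1) by (intro poly_eq_of_infinite_field [OF inf]) simp
    have "(\<Sum>i\<in>UNIV. \<Sum>j\<in>UNIV. c i j * ((J_mat ** S) $ i $ j)) =
        (\<Sum>i\<in>UNIV. \<Sum>j\<in>UNIV. \<Sum>k\<in>UNIV. c i j * J_mat $ i $ k * (S $ k $ j))"
      by (simp add: matrix_matrix_mult_def sum_distrib_left mult.assoc)
    also have "\<dots> = (\<Sum>j\<in>UNIV. \<Sum>i\<in>UNIV. \<Sum>k\<in>UNIV. c i j * J_mat $ i $ k * (S $ k $ j))"
      by (rule sum.swap)
    also have "\<dots> = (\<Sum>j\<in>UNIV. \<Sum>k\<in>UNIV. \<Sum>i\<in>UNIV. c i j * J_mat $ i $ k * (S $ k $ j))"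
      by (intro sum.cong refl sum.swap)
    also have "\<dots> = (\<Sum>k\<in>UNIV. \<Sum>j\<in>UNIV. \<Sum>i\<in>UNIV. c i j * J_mat $ i $ k * (S $ k $ j))"
      by (rule sum.swap)
    also have "\<dots> = (\<Sum>k\<in>UNIV. \<Sum>j\<in>UNIV. d k j * (S $ k $ j))"
      by (simp add: d_def sum_distrib_right)
    finally show ?thesis
      by (simp add: \<open>p = p'\<close> p'(2))
  qed
  have quadratic: "(\<Sum>k\<in>UNIV. \<Sum>j\<in>UNIV. d k j * (v $ k * v $ j)) = 0" for v
  proof -
    \<comment> \<open>The whole line lies in \<open>Sp\<close>, so the zero polynomial represents f
      along it.\<close>
    have "\<forall>t. poly 0 t = f (mat 1 + mat t ** (J_mat ** outer v))"
      using vanish transvection_in_Sp [OF char] by (metis poly_0)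
    from deriv [OF this] show ?thesis
      by (simp add: outer_def)
  qed
  have sum_axis: "(\<Sum>k\<in>UNIV. \<Sum>j\<in>UNIV. d k j * (axis a 1 $ k * axis b 1 $ j)) = d a b" for a b
  proof -
    have "(\<Sum>k\<in>UNIV. \<Sum>j\<in>UNIV. d k j * (axis a 1 $ k * axis b 1 $ j)) =
        (\<Sum>k\<in>UNIV. if k = a then \<Sum>j\<in>UNIV. if j = b then d k j else 0 else 0)"
      by (intro sum.cong refl) (auto simp: axis_def if_distrib [where f = "\<lambda>c. _ * c"] cong: if_cong)
    then show ?thesis
      by simp
  qed
  have diag: "d a a = 0" for a
    using quadratic [of "axis a 1"] by (simp only: sum_axis)
  \<comment> \<open>Polarization: at the sum of two basis vectors the diagonal contributions vanish
    and the two mixed ones remain.\<close>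
  have alt: "d a b + d b a = 0" for a b
  proof -
    let ?u = "axis a 1 :: 'k ^ ('n + 'n)" and ?v = "axis b 1 :: 'k ^ ('n + 'n)"
    have "(\<Sum>k\<in>UNIV. \<Sum>j\<in>UNIV. d k j * ((?u + ?v) $ k * (?u + ?v) $ j)) =
        (\<Sum>k\<in>UNIV. \<Sum>j\<in>UNIV. d k j * (?u $ k * ?u $ j)) +
        (\<Sum>k\<in>UNIV. \<Sum>j\<in>UNIV. d k j * (?u $ k * ?v $ j)) +
        ((\<Sum>k\<in>UNIV. \<Sum>j\<in>UNIV. d k j * (?v $ k * ?u $ j)) +
         (\<Sum>k\<in>UNIV. \<Sum>j\<in>UNIV. d k j * (?v $ k * ?v $ j)))"
      by (simp only: vector_add_component distrib_left distrib_right sum.distrib add_ac)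
    then show ?thesis
      by (simp only: quadratic sum_axis diag add_0_left add_0_right)
  qed
  \<comment> \<open>As J squares to 1, x = J S, so x is a direction of the form handled by
    \<open>deriv\<close>.\<close>
  define S where "S = J_mat ** x"
  have "transpose S = S"
    using x by (simp add: S_def g_theta_iff matrix_transpose_mul transpose_J_mat)
  moreover have "transpose S $ i $ j = S $ j $ i" for i j
    by (simp add: transpose_def)
  ultimately have S: "S $ i $ j = S $ j $ i" for i j
    by simp
  have "(\<Sum>k\<in>UNIV. \<Sum>j\<in>UNIV. d k j * (S $ k $ j)) = 0"
  proof (rule sum_alternating_eq_0)
    fix k j
    have "d k j * S $ k $ j + d j k * S $ j $ k = (d k j + d j k) * S $ k $ j"
      by (simp add: S [of j k] distrib_right)
    then show "d k j * S $ k $ j + d j k * S $ j $ k = 0"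
      by (simp add: alt)
  qed (simp_all add: diag)
  then show "poly (pderiv q) 0 = 0"
    using deriv [of q S] q by (simp add: S_def J_mat_cancel)
qed

lemma g_theta_nil_eq_sp_nil:
  assumes "CHAR('k::alg_closed_field) = 2"
  shows "(g_theta_nil :: ('k, 'n::finite) gl set) = sp_nil"
  using g_theta_subset_sp [OF infinite_UNIV_alg_closed assms] sp_subset_g_theta [OF assms]
  by (auto simp: g_theta_nil_def sp_nil_def)

section \<open>The isomorphism\<close>

text \<open>At g = 1 both sides of the linear equation are J, so subtracting 1 preserves it.
  Conversely, invertibility of g comes from determinant 1.\<close>

lemma G_iota_theta_uni_iff:
  fixes g :: "('k::field, 'n::finite) gl"
  assumes char: "CHAR('k) = 2"
  shows "g \<in> G_iota_theta_uni \<longleftrightarrow> g - mat 1 \<in> g_theta_nil"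
proof -
  have "invertible g" if "nilpotent_mat (g - mat 1)"
    using det_one_plus_nilpotent [OF char that] by (simp add: invertible_det_nz)
  moreover have "J_mat ** (g - mat 1) = transpose (g - mat 1) ** J_mat \<longleftrightarrow>
      J_mat ** g = transpose g ** J_mat"
    by (simp add: matrix_diff_ldistrib matrix_diff_rdistrib transpose_diff)
  ultimately show ?thesis
    by (auto simp: G_iota_theta_uni_def G_iota_theta_iff g_theta_nil_def g_theta_iff
        unipotent_mat_def)
qed

lemma variety_isomorphism_minus_one:
  assumes char: "CHAR('k::field) = 2"
  shows "variety_isomorphism GL_regular G_iota_theta_uni gl_regular
    (g_theta_nil :: ('k, 'n::finite) gl set) (\<lambda>g. g - mat 1)"
  unfolding variety_isomorphism_def
proof (intro conjI exI [of _ "\<lambda>x. x + mat 1"])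
  show "regular_map GL_regular G_iota_theta_uni gl_regular
    (g_theta_nil :: ('k, 'n) gl set) (\<lambda>g. g - mat 1)"
    unfolding regular_map_def
  proof (intro conjI ballI)
    fix f :: "('k, 'n) gl \<Rightarrow> 'k"
    assume f: "f \<in> gl_regular"
    have "(\<lambda>g. f (g - mat 1)) \<in> gl_regular"
      using gl_regular_translate [OF f, of "- mat 1"] by simp
    \<comment> \<open>A polynomial is a fraction with denominator det^0.\<close>
    then have "(\<lambda>g. f (g - mat 1)) \<in> GL_regular"
      unfolding GL_regular_def by (auto intro!: bexI exI [of _ 0])
    then show "\<exists>g\<in>GL_regular. \<forall>x\<in>G_iota_theta_uni. f (x - mat 1) = g x"
      by (intro bexI [of _ "\<lambda>g. f (g - mat 1)"]) simp_all
  qed (auto simp: G_iota_theta_uni_iff [OF char])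
next
  show "regular_map gl_regular (g_theta_nil :: ('k, 'n) gl set) GL_regular
    G_iota_theta_uni (\<lambda>x. x + mat 1)"
    unfolding regular_map_def
  proof (intro conjI ballI)
    fix f :: "('k, 'n) gl \<Rightarrow> 'k"
    assume "f \<in> GL_regular"
    then obtain p r where p: "p \<in> gl_regular" and f: "\<And>g. invertible g \<Longrightarrow> f g = p g / det g ^ r"
      by (auto simp: GL_regular_def)
    \<comment> \<open>On unipotent matrices the denominator is a power of 1, so f restricts to its
      polynomial numerator.\<close>
    have "f (x + mat 1) = p (x + mat 1)" if "x \<in> g_theta_nil" for x
    proof -
      have "det (x + mat 1) = 1"
        using that det_one_plus_nilpotent [OF char, of x] by (simp add: g_theta_nil_def add.commute)
      then show ?thesis
        using f by (simp add: invertible_det_nz)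
    qed
    then show "\<exists>g\<in>gl_regular. \<forall>x\<in>g_theta_nil. f (x + mat 1) = g x"
      using gl_regular_translate [OF p] by (intro bexI [of _ "\<lambda>x. p (x + mat 1)"]) simp_all
  qed (auto simp: G_iota_theta_uni_iff [OF char])
qed auto

text \<open>Equivariance sends the orbit of x onto that of its image. Stability keeps orbits inside
  X, where an injective map is also injective on subsets.\<close>

lemma bij_betw_conj_orbits:
  assumes "bij_betw \<phi> X Y" and stable: "conj_stable H X"
    and equivariant: "\<And>h x. h \<in> H \<Longrightarrow> x \<in> X \<Longrightarrow> \<phi> (conj_act h x) = conj_act h (\<phi> x)"
  shows "bij_betw ((`) \<phi>) (conj_orbits H X) (conj_orbits H Y)"
  unfolding bij_betw_def
proof
  have inj: "inj_on \<phi> X" and image: "\<phi> ` X = Y"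
    using assms(1) by (auto simp: bij_betw_def)
  have "conj_orbits H X \<subseteq> Pow X"
    using stable by (auto simp: conj_orbits_def conj_stable_def)
  then show "inj_on ((`) \<phi>) (conj_orbits H X)"
    by (rule inj_on_subset [OF inj_on_image_Pow [OF inj]])
  have "\<phi> ` (\<lambda>h. conj_act h x) ` H = (\<lambda>h. conj_act h (\<phi> x)) ` H" if "x \<in> X" for x
    using equivariant that by (simp add: image_image)
  then show "((`) \<phi>) ` conj_orbits H X = conj_orbits H Y"
    by (simp add: conj_orbits_def image_image image [symmetric])
qed

theorem proposition1p7:
  assumes "CHAR('k::alg_closed_field) = 2"
  shows "(G_theta :: ('k, 'n::finite) gl set) = Sp \<and>
    (g_theta_nil :: ('k, 'n) gl set) = sp_nil \<and>
    conj_stable (G_theta :: ('k, 'n) gl set) G_iota_theta_uni \<and>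
    conj_stable (Sp :: ('k, 'n) gl set) sp_nil \<and>
    (\<exists>\<phi> :: ('k, 'n) gl \<Rightarrow> ('k, 'n) gl.
       variety_isomorphism GL_regular G_iota_theta_uni gl_regular sp_nil \<phi> \<and>
       (\<forall>h \<in> G_theta. \<forall>g \<in> G_iota_theta_uni. \<phi> (conj_act h g) = conj_act h (\<phi> g)) \<and>
       bij_betw ((`) \<phi>) (conj_orbits G_theta G_iota_theta_uni) (conj_orbits Sp sp_nil))"
proof -
  have equivariant: "conj_act h g - mat 1 = conj_act h (g - mat 1)"
    if "h \<in> Sp" for h g :: "('k, 'n) gl"
    by (simp add: conj_act_diff conj_act_mat_1 Sp_invertible that)
  have "bij_betw (\<lambda>g. g - mat 1) G_iota_theta_uni (g_theta_nil :: ('k, 'n) gl set)"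
    by (rule bij_betw_byWitness [where f' = "\<lambda>x. x + mat 1"])
      (auto simp: G_iota_theta_uni_iff [OF assms])
  then have "bij_betw ((`) (\<lambda>g. g - mat 1)) (conj_orbits Sp G_iota_theta_uni)
      (conj_orbits Sp (g_theta_nil :: ('k, 'n) gl set))"
    using conj_stable_G_iota_theta_uni equivariant by (rule bij_betw_conj_orbits)
  then show ?thesis
    unfolding G_theta_eq_Sp g_theta_nil_eq_sp_nil [OF assms, symmetric]
    using conj_stable_G_iota_theta_uni conj_stable_g_theta_nil
      variety_isomorphism_minus_one [OF assms] equivariant by blast
qed

end
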